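(* Let $a,b,n$ be positive integers. Then $$i(C_n^{a,b},t)=\sum_{\lambda\vdash n}\frac1{z_\lambda}\, i(U_\lambda^{a,b},t),$$ where the sum is over all partitions $\lambda=(\lambda_1,\dots,\lambda_k)$ of $n$ and $i(U_\lambda^{a,b},t)=\prod_{j=1}^k i(U_{\lambda_j}^{a,b},t)$.
   Context: For $m\ge1$, $U_m^{a,b}=U_{mb,m(a+b)}$ is the uniform matroid of rank $mb$ on $m(a+b)$ elements. For $S\subseteq[N]$, the Schubert matroid $\mathrm{SM}_N(S)$ is the matroid on $[N]$ whose bases are the $T\subseteq[N]$ with $|T|=|S|$ such that for every $i$ the $i$-th smallest element of $T$ is at most the $i$-th smallest element of $S$. The $(a,b)$-Catalan matroid $C_n^{a,b}$ is $\mathrm{SM}_{n(a+b)}(S)$ where $S$ has indicator vector $(0^a,1^b,\dots,0^a,1^b)$ ($n$ blocks of $a$ zeros followed by $b$ ones). For a partition $\lambda$ of $n$ in which $i$ appears $\alpha_i$ times, $z_\lambda=\prod_i i^{\alpha_i}\alpha_i!$. For a matroid $M$ on $[N]$, $\mathcal P(M)=\mathrm{conv}\{e_B: B\text{ a basis of }M\}\subset\mathbb R^N$, and $i(M,t)$ is its Ehrhart polynomial: the polynomial with $i(M,t)=|t\mathcal P(M)\cap\mathbb Z^N|$ for all positive integers $t$. *)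

theory Defs
  imports
    "HOL-Analysis.Analysis"
    "HOL-Computational_Algebra.Polynomial"
    "HOL-Library.Multiset"
    "HOL-Library.Poly_Mapping"
    "HOL-Analysis.Finite_Function_Topology"
begin

section \<open>Matroids\<close>

text \<open>A matroid is given by its ground set and its set of bases.\<close>

type_synonym 'a matroid = "'a set \<times> 'a set set"

abbreviation ground :: "'a matroid \<Rightarrow> 'a set" where "ground \<equiv> fst"
abbreviation bases :: "'a matroid \<Rightarrow> 'a set set" where "bases \<equiv> snd"

definition is_matroid :: "'a matroid \<Rightarrow> bool" where
  "is_matroid M \<longleftrightarrow> finite (ground M) \<and> bases M \<subseteq> Pow (ground M) \<and> bases M \<noteq> {} \<and>
     (\<forall>A\<in>bases M. \<forall>B\<in>bases M. \<forall>x\<in>A - B. \<exists>y\<in>B - A. insert y (A - {x}) \<in> bases M)"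

definition uniform_matroid :: "nat \<Rightarrow> nat \<Rightarrow> nat matroid" where
  "uniform_matroid k N = ({1..N}, {B. B \<subseteq> {1..N} \<and> card B = k})"

text \<open>List positions are counted from 0, so \<open>sorted_list_of_set T ! i\<close> is the
  \<open>(i+1)\<close>-th smallest element of \<open>T\<close>.\<close>

definition schubert_matroid :: "nat \<Rightarrow> nat set \<Rightarrow> nat matroid" where
  "schubert_matroid N S = ({1..N},
     {T. T \<subseteq> {1..N} \<and> card T = card S \<and>
         (\<forall>i<card S. sorted_list_of_set T ! i \<le> sorted_list_of_set S ! i)})"

definition catalan_word :: "nat \<Rightarrow> nat \<Rightarrow> nat \<Rightarrow> nat list" where
  "catalan_word a b n = concat (replicate n (replicate a 0 @ replicate b 1))"

definition catalan_set :: "nat \<Rightarrow> nat \<Rightarrow> nat \<Rightarrow> nat set" where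
  "catalan_set a b n = {i \<in> {1..n * (a + b)}. catalan_word a b n ! (i - 1) = 1}"

definition catalan_matroid :: "nat \<Rightarrow> nat \<Rightarrow> nat \<Rightarrow> nat matroid" where
  "catalan_matroid a b n = schubert_matroid (n * (a + b)) (catalan_set a b n)"

definition uniform_ab :: "nat \<Rightarrow> nat \<Rightarrow> nat \<Rightarrow> nat matroid" where
  "uniform_ab a b m = uniform_matroid (m * b) (m * (a + b))"


section \<open>Matroid polytopes and Ehrhart polynomials\<close>

text \<open>A point of \<open>\<real>\<^sup>E\<close> (\<open>E\<close> a finite set) is a finitely supported function
  vanishing outside \<open>E\<close>, so that \<open>E\<close> need not be a type.\<close>

definition indicator_vec :: "'a set \<Rightarrow> 'a \<Rightarrow>\<^sub>0 real" where
  "indicator_vec B = (\<Sum>i\<in>B. Poly_Mapping.single i 1)"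

definition matroid_polytope :: "'a matroid \<Rightarrow> ('a \<Rightarrow>\<^sub>0 real) set" where
  "matroid_polytope M = convex hull (indicator_vec ` bases M)"

definition int_lattice :: "'a set \<Rightarrow> ('a \<Rightarrow>\<^sub>0 real) set" where
  "int_lattice E = {x. Poly_Mapping.keys x \<subseteq> E \<and> (\<forall>i. Poly_Mapping.lookup x i \<in> \<int>)}"

definition lattice_count :: "'a matroid \<Rightarrow> nat \<Rightarrow> nat" where
  "lattice_count M t = card ((*\<^sub>R) (real t) ` matroid_polytope M \<inter> int_lattice (ground M))"

definition is_ehrhart_poly :: "'a matroid \<Rightarrow> real poly \<Rightarrow> bool" where
  "is_ehrhart_poly M p \<longleftrightarrow> (\<forall>t::nat. t \<ge> 1 \<longrightarrow> poly p (real t) = real (lattice_count M t))"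

text \<open>Existence is Ehrhart's theorem (for a matroid, the polytope has integral vertices);
  uniqueness is shown below.\<close>

definition ehrhart_poly :: "'a matroid \<Rightarrow> real poly" where
  "ehrhart_poly M = (THE p. is_ehrhart_poly M p)"

lemma is_ehrhart_poly_unique:
  assumes "is_ehrhart_poly M p" "is_ehrhart_poly M q"
  shows "p = q"
proof (rule ccontr)
  assume "p \<noteq> q"
  then have "finite {x. poly (p - q) x = 0}"
    by (intro poly_roots_finite) simp
  moreover have "real ` {1..} \<subseteq> {x. poly (p - q) x = 0}"
    using assms by (auto simp: is_ehrhart_poly_def)
  ultimately have "finite (real ` {1..})"
    by (rule rev_finite_subset)
  then have "finite {1::nat..}"
    by (rule finite_imageD) (simp add: inj_on_def)
  then show False
    using infinite_Ici by blast
qed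

lemma ehrhart_poly_eqI: "is_ehrhart_poly M p \<Longrightarrow> ehrhart_poly M = p"
  unfolding ehrhart_poly_def by (blast intro: is_ehrhart_poly_unique)


section \<open>Partitions\<close>

text \<open>A partition of \<open>n\<close> is the multiset of its (positive) parts.\<close>

definition partitions_of :: "nat \<Rightarrow> nat multiset set" where
  "partitions_of n = {\<mu>. 0 \<notin># \<mu> \<and> \<Sum>\<^sub># \<mu> = n}"

definition z_partition :: "nat multiset \<Rightarrow> nat" where
  "z_partition \<mu> = (\<Prod>i\<in>set_mset \<mu>. i ^ count \<mu> i * fact (count \<mu> i))"

definition ehrhart_poly_uniform_prod :: "nat \<Rightarrow> nat \<Rightarrow> nat multiset \<Rightarrow> real poly" where
  "ehrhart_poly_uniform_prod a b \<mu> = (\<Prod>j\<in>#\<mu>. ehrhart_poly (uniform_ab a b j))"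

lemma finite_partitions_of: "finite (partitions_of n)"
proof -
  have "size A \<le> \<Sum>\<^sub># A" if "0 \<notin># A" for A :: "nat multiset"
    using that by (induction A) auto
  moreover have "x \<le> \<Sum>\<^sub># A" if "x \<in># A" for x :: nat and A
    using that by (induction A) auto
  ultimately have "partitions_of n \<subseteq> (\<Union>k\<le>n. multisets_of_size {..n} k)"
    by (auto simp: partitions_of_def multisets_of_size_def)
  then show ?thesis
    by (rule finite_subset) auto
qed


section \<open>The uniform and Schubert set systems are matroids\<close>

lemma is_matroid_uniform:
  assumes "k \<le> N"
  shows "is_matroid (uniform_matroid k N)"
  unfolding is_matroid_def
proof (intro conjI ballI)
  show "bases (uniform_matroid k N) \<noteq> {}"
    using assms obtain_subset_with_card_n[of k "{1..N}"]
    by (auto simp: uniform_matroid_def)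
next
  fix A B x
  assume "A \<in> bases (uniform_matroid k N)" "B \<in> bases (uniform_matroid k N)" and x: "x \<in> A - B"
  then have A: "A \<subseteq> {1..N}" "card A = k" and B: "B \<subseteq> {1..N}" "card B = k"
    by (auto simp: uniform_matroid_def)
  have fin: "finite A" "finite B"
    using A B by (auto intro: finite_subset)
  have "\<not> B \<subseteq> A"
    using card_subset_eq[of A B] fin A B x by auto
  then obtain y where y: "y \<in> B - A"
    by blast
  moreover have "card (insert y (A - {x})) = k"
    using x y fin A(2) by (simp add: card_Diff_singleton) (metis Suc_pred card_gt_0_iff empty_iff)
  ultimately show "\<exists>y\<in>B - A. insert y (A - {x}) \<in> bases (uniform_matroid k N)"
    using A B by (auto simp: uniform_matroid_def intro!: bexI[of _ y])
qed (auto simp: uniform_matroid_def)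

lemma nth_sorted_list_of_set_le_iff:
  fixes T :: "nat set"
  assumes "finite T" "i < card T"
  shows "sorted_list_of_set T ! i \<le> j \<longleftrightarrow> i < card (T \<inter> {..j})"
proof -
  define xs where "xs = sorted_list_of_set T"
  have xs: "sorted xs" "distinct xs" "set xs = T" "length xs = card T"
    using assms by (auto simp: xs_def)
  define I where "I = {k. k < length xs \<and> xs ! k \<le> j}"
  have "T \<inter> {..j} = (!) xs ` I"
    unfolding xs(3)[symmetric] I_def by (auto simp: set_conv_nth)
  moreover have "inj_on ((!) xs) I"
    using xs(2) by (auto simp: I_def inj_on_def nth_eq_iff_index_eq)
  ultimately have c: "card (T \<inter> {..j}) = card I"
    by (simp add: card_image)
  have fin: "finite I"
    by (simp add: I_def)
  show ?thesis
  proof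
    assume "sorted_list_of_set T ! i \<le> j"
    then have *: "xs ! i \<le> j"
      by (simp add: xs_def)
    have "{..i} \<subseteq> I"
    proof
      fix k assume "k \<in> {..i}"
      then have "xs ! k \<le> xs ! i" "k < length xs"
        using sorted_nth_mono[OF xs(1), of k i] assms(2) xs(4) by simp_all
      with * show "k \<in> I"
        unfolding I_def by simp
    qed
    from card_mono[OF fin this] show "i < card (T \<inter> {..j})"
      using c by simp
  next
    assume *: "i < card (T \<inter> {..j})"
    have "\<not> I \<subseteq> {..<i}"
      using card_mono[of "{..<i}" I] c * by auto
    then obtain k where k: "k < length xs" "xs ! k \<le> j" "i \<le> k"
      unfolding I_def by (auto simp: subset_iff not_less)
    then have "xs ! i \<le> j"
      using sorted_nth_mono[OF xs(1), of i k] by simp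
    then show "sorted_list_of_set T ! i \<le> j"
      by (simp add: xs_def)
  qed
qed

lemma bases_schubert_iff:
  assumes "S \<subseteq> {1..N}"
  shows "T \<in> bases (schubert_matroid N S) \<longleftrightarrow>
    T \<subseteq> {1..N} \<and> card T = card S \<and> (\<forall>j. card (S \<inter> {..j}) \<le> card (T \<inter> {..j}))"
proof -
  have "(\<forall>i<card S. sorted_list_of_set T ! i \<le> sorted_list_of_set S ! i) \<longleftrightarrow>
      (\<forall>j. card (S \<inter> {..j}) \<le> card (T \<inter> {..j}))" (is "?L \<longleftrightarrow> ?R")
    if T: "T \<subseteq> {1..N}" "card T = card S"
  proof -
    have fin: "finite S" "finite T"
      using assms T by (auto intro: finite_subset)
    show ?thesis
    proof
      assume L: ?L
      show ?R
      proof (rule allI, rule ccontr)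
        fix j
        assume *: "\<not> card (S \<inter> {..j}) \<le> card (T \<inter> {..j})"
        define i where "i = card (T \<inter> {..j})"
        have i: "i < card (S \<inter> {..j})"
          using * by (simp add: i_def)
        also have "\<dots> \<le> card S"
          using fin by (simp add: card_mono)
        finally have iS: "i < card S" .
        have "sorted_list_of_set S ! i \<le> j"
          using nth_sorted_list_of_set_le_iff[OF fin(1) iS] i by simp
        then have "sorted_list_of_set T ! i \<le> j"
          using L iS le_trans by blast
        then have "i < card (T \<inter> {..j})"
          using nth_sorted_list_of_set_le_iff[OF fin(2), of i j] iS T by simp
        then show False
          by (simp add: i_def)
      qed
    next
      assume R: ?R
      show ?L
      proof (intro allI impI)
        fix i assume i: "i < card S"
        have "i < card (S \<inter> {..sorted_list_of_set S ! i})"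
          using nth_sorted_list_of_set_le_iff[OF fin(1) i] by blast
        then have "i < card (T \<inter> {..sorted_list_of_set S ! i})"
          using R less_le_trans by blast
        then show "sorted_list_of_set T ! i \<le> sorted_list_of_set S ! i"
          using nth_sorted_list_of_set_le_iff[OF fin(2)] i T by simp
      qed
    qed
  qed
  then show ?thesis
    by (auto simp: schubert_matroid_def)
qed

lemma is_matroid_schubert:
  assumes S: "S \<subseteq> {1..N}"
  shows "is_matroid (schubert_matroid N S)"
  unfolding is_matroid_def
proof (intro conjI ballI)
  have "S \<in> bases (schubert_matroid N S)"
    using S by (simp add: schubert_matroid_def)
  then show "bases (schubert_matroid N S) \<noteq> {}"
    by blast
next
  fix A B x
  assume "A \<in> bases (schubert_matroid N S)" "B \<in> bases (schubert_matroid N S)" and x: "x \<in> A - B"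
  then have A: "A \<subseteq> {1..N}" "card A = card S" "\<And>j. card (S \<inter> {..j}) \<le> card (A \<inter> {..j})"
    and B: "B \<subseteq> {1..N}" "card B = card S" "\<And>j. card (S \<inter> {..j}) \<le> card (B \<inter> {..j})"
    unfolding bases_schubert_iff[OF S] by auto
  have fin: "finite A" "finite B"
    using A(1) B(1) by (auto intro: finite_subset)
  have "\<not> B \<subseteq> A"
    using card_subset_eq[of A B] fin A(2) B(2) x by auto
  then have ne: "B - A \<noteq> {}"
    by blast
  define y where "y = Min (B - A)"
  have y: "y \<in> B - A" and ymin: "\<And>w. w \<in> B - A \<Longrightarrow> y \<le> w"
    using ne fin by (auto simp: y_def simp del: Diff_iff intro: Min_in)
  define C where "C = insert y (A - {x})"
  have finC: "finite C"
    using fin by (simp add: C_def)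
  have "card C = card S"
    using x y fin A(2) by (simp add: C_def card_Diff_singleton) (metis Suc_pred card_gt_0_iff empty_iff)
  moreover have "card (S \<inter> {..j}) \<le> card (C \<inter> {..j})" for j
  proof (cases "y \<le> j")
    case True
    have "card (A \<inter> {..j}) \<le> Suc (card (A \<inter> {..j} - {x}))"
      using fin card_Suc_Diff1[of "A \<inter> {..j}" x] by (cases "x \<le> j") (use x in auto)
    also have "\<dots> = card (insert y (A \<inter> {..j} - {x}))"
      using y fin by simp
    also have "insert y (A \<inter> {..j} - {x}) = C \<inter> {..j}"
      using True by (auto simp: C_def)
    finally show ?thesis
      using A(3)[of j] by simp
  next
    case False
    then have "B \<inter> {..j} \<subseteq> C \<inter> {..j}"
      using x ymin by (fastforce simp: C_def)
    then have "card (B \<inter> {..j}) \<le> card (C \<inter> {..j})"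
      using finC by (intro card_mono) auto
    then show ?thesis
      using B(3)[of j] by simp
  qed
  moreover have "C \<subseteq> {1..N}"
    using A(1) B(1) y by (auto simp: C_def)
  ultimately have "C \<in> bases (schubert_matroid N S)"
    unfolding bases_schubert_iff[OF S] by blast
  then show "\<exists>y\<in>B - A. insert y (A - {x}) \<in> bases (schubert_matroid N S)"
    using y by (auto simp: C_def)
qed (auto simp: schubert_matroid_def)

lemma is_matroid_catalan: "is_matroid (catalan_matroid a b n)"
  unfolding catalan_matroid_def by (rule is_matroid_schubert) (auto simp: catalan_set_def)

lemma is_matroid_uniform_ab: "is_matroid (uniform_ab a b m)"
  unfolding uniform_ab_def by (rule is_matroid_uniform) simp

end

theory Submission
  imports Defs
begin

text \<open>Cut a lattice point of the \<open>t\<close>-th dilate of either polytope into \<open>n\<close> blocks of length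
  \<open>a + b\<close> and let each block contribute its coordinate sum minus \<open>t b\<close>. Lattice points for
  \<open>U\<^sub>m\<close> are then the bridges (walks of \<open>m\<close> steps ending at \<open>0\<close>) and those for the Catalan matroid
  are the excursions (nonnegative bridges): the prefix inequalities need only be checked at block
  ends because every coordinate is at most \<open>t\<close>. Cutting an excursion with a marked step at the last
  zero before the mark, and rotating the second piece to start at the mark, is a bijection onto
  pairs of an excursion and a nonempty bridge, so \<open>n C\<^sub>n = \<Sum> U\<^sub>m C\<^sub>n\<^sub>-\<^sub>m\<close>. This is the Newton recurrence
  that characterises \<open>\<Sum> U\<^sub>\<lambda> / z\<^sub>\<lambda>\<close>.\<close>

section \<open>Bridges and excursions\<close>

text \<open>Letters are abstract and carry a weight \<open>f\<close>, because different blocks of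
  coordinates with equal sums must count as different steps of the walk.\<close>

definition height :: "('a \<Rightarrow> int) \<Rightarrow> 'a list \<Rightarrow> int" where
  "height f w = sum_list (map f w)"

lemma height_Nil [simp]: "height f [] = 0"
  and height_append [simp]: "height f (u @ v) = height f u + height f v"
  by (simp_all add: height_def)

definition bridges :: "('a \<Rightarrow> int) \<Rightarrow> 'a set \<Rightarrow> nat \<Rightarrow> 'a list set" where
  "bridges f A n = {w. set w \<subseteq> A \<and> length w = n \<and> height f w = 0}"

definition excursions :: "('a \<Rightarrow> int) \<Rightarrow> 'a set \<Rightarrow> nat \<Rightarrow> 'a list set" where
  "excursions f A n = {w \<in> bridges f A n. \<forall>i. 0 \<le> height f (take i w)}"

lemma finite_bridges: "finite A \<Longrightarrow> finite (bridges f A n)"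
  by (rule finite_subset[OF _ finite_lists_length_eq[of A n]]) (auto simp: bridges_def)

lemma finite_excursions: "finite A \<Longrightarrow> finite (excursions f A n)"
  by (rule finite_subset[OF _ finite_bridges[of A f n]]) (auto simp: excursions_def)

text \<open>The weak inequality before \<open>s\<close> and the strict one after it single out the
  last of possibly several minima. A bridge will be cut there.\<close>

definition last_min :: "('a \<Rightarrow> int) \<Rightarrow> 'a list \<Rightarrow> nat \<Rightarrow> bool" where
  "last_min f w s \<longleftrightarrow> s \<le> length w \<and>
     (\<forall>j\<le>s. height f (take s w) \<le> height f (take j w)) \<and>
     (\<forall>j. s < j \<and> j \<le> length w \<longrightarrow> height f (take s w) < height f (take j w))"

text \<open>Here \<open>p\<close> is the mark; the piece of the excursion up to \<open>q\<close>
  will be split off.\<close>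

definition last_zero :: "('a \<Rightarrow> int) \<Rightarrow> 'a list \<Rightarrow> nat \<Rightarrow> nat \<Rightarrow> bool" where
  "last_zero f w p q \<longleftrightarrow> q \<le> p \<and> height f (take q w) = 0 \<and>
     (\<forall>j. q < j \<and> j \<le> p \<longrightarrow> height f (take j w) \<noteq> 0)"

lemma last_min_unique:
  assumes "last_min f w s" "last_min f w s'"
  shows "s = s'"
proof (rule linorder_cases[of s s'])
  have False if "last_min f w s" "last_min f w s'" "s < s'" for s s'
  proof -
    have "height f (take s w) < height f (take s' w)" "height f (take s' w) \<le> height f (take s w)"
      using that unfolding last_min_def by auto
    then show False
      by simp
  qed
  then show "s < s' \<Longrightarrow> s = s'" "s' < s \<Longrightarrow> s = s'"
    using assms by blast+
qed simp

lemma last_zero_unique: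
  assumes "last_zero f w p q" "last_zero f w p q'"
  shows "q = q'"
proof (rule linorder_cases[of q q'])
  have False if "last_zero f w p q" "last_zero f w p q'" "q < q'" for q q'
    using that unfolding last_zero_def by blast
  then show "q < q' \<Longrightarrow> q = q'" "q' < q \<Longrightarrow> q = q'"
    using assms by blast+
qed simp

lemma last_min_exists: "\<exists>s. last_min f w s"
proof -
  define H where "H i = height f (take i w)" for i
  define I where "I = {i. i \<le> length w \<and> H i = Min (H ` {..length w})}"
  have "finite I"
    by (simp add: I_def)
  have min: "Min (H ` {..length w}) \<le> H i" if "i \<le> length w" for i
    using that by (intro Min_le) auto
  have "Min (H ` {..length w}) \<in> H ` {..length w}"
    by (intro Min_in) auto
  then obtain i where "i \<le> length w" "H i = Min (H ` {..length w})"
    by force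
  then have "i \<in> I"
    by (simp add: I_def)
  then have "I \<noteq> {}"
    by blast
  then have mem: "Max I \<in> I"
    using \<open>finite I\<close> by (rule Max_in[rotated])
  have "H (Max I) < H j" if "Max I < j" "j \<le> length w" for j
  proof -
    have "j \<notin> I"
      using that Max_ge[OF \<open>finite I\<close>, of j] by auto
    then have "H j \<noteq> Min (H ` {..length w})"
      using that by (simp add: I_def)
    moreover have "H (Max I) = Min (H ` {..length w})"
      using mem by (simp add: I_def)
    ultimately show ?thesis
      using min[of j] that by linarith
  qed
  then have "last_min f w (Max I)"
    using mem min unfolding last_min_def H_def[symmetric] by (auto simp: I_def)
  then show ?thesis ..
qed

lemma last_zero_exists: "\<exists>q. last_zero f w p q"
proof -
  define I where "I = {i. i \<le> p \<and> height f (take i w) = 0}"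
  have "finite I"
    by (simp add: I_def)
  have "0 \<in> I"
    by (simp add: I_def)
  then have mem: "Max I \<in> I"
    using \<open>finite I\<close> by (intro Max_in) auto
  have "height f (take j w) \<noteq> 0" if "Max I < j" "j \<le> p" for j
  proof -
    have "j \<notin> I"
      using that(1) Max_ge[OF \<open>finite I\<close>, of j] by auto
    then show ?thesis
      using that(2) by (simp add: I_def)
  qed
  moreover have "Max I \<le> p" "height f (take (Max I) w) = 0"
    using mem unfolding I_def by blast+
  ultimately have "last_zero f w p (Max I)"
    unfolding last_zero_def by blast
  then show ?thesis ..
qed

section \<open>Cutting and rotating walks\<close>

lemma height_take_drop: "height f (take j (drop s w)) = height f (take (s + j) w) - height f (take s w)"
  by (simp add: take_add)

text \<open>A nonempty bridge ends at its starting height 0, so position 0 is never the last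
  minimum. Hence the mark \<open>n - s\<close> recovered from \<open>s\<close> is smaller than
  \<open>n\<close>.\<close>

lemma last_min_pos:
  assumes "w \<in> bridges f A m" "m \<ge> 1" "last_min f w s"
  shows "s \<ge> 1"
proof (rule ccontr)
  assume "\<not> s \<ge> 1"
  then have "s = 0"
    by simp
  moreover have "length w = m" "height f w = 0"
    using assms by (simp_all add: bridges_def)
  ultimately show False
    using assms(2,3) by (auto simp: last_min_def dest!: spec[of _ m])
qed

text \<open>Started from a minimum, the rotated bridge stays nonnegative. As the minimum is the last
  one, heights stay strictly positive up to the old end of \<open>w\<close>, now at position
  \<open>l + m - s\<close>; with the mark there, the last zero is \<open>l\<close>.\<close>

lemma excursion_of_bridge:
  assumes e: "e \<in> excursions f A l" and w: "w \<in> bridges f A m" and s: "last_min f w s"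
  defines "g \<equiv> e @ drop s w @ take s w"
  shows "g \<in> excursions f A (l + m)" "last_zero f g (l + m - s) l"
proof -
  have len: "length e = l" "length w = m" "s \<le> m" and he: "height f e = 0"
    using e w s by (auto simp: excursions_def bridges_def last_min_def)
  have hw: "height f w = 0" "height f (take s w) + height f (drop s w) = 0"
    using w height_append[of f "take s w" "drop s w"] by (auto simp: bridges_def)
  have smin: "height f (take s w) \<le> height f (take j w)" for j
    using s len hw(1) unfolding last_min_def
    by (metis le_cases less_imp_le not_less take_all)
  have smin': "height f (take s w) < height f (take j w)" if "s < j" "j \<le> m" for j
    using s that len by (auto simp: last_min_def)
  have tk: "height f (take i g) = height f (take i e) + height f (take (i - l) (drop s w)) +
      height f (take (i - l - (m - s)) (take s w))" for i
    using len by (simp add: g_def)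
  have v0: "0 \<le> height f (take j (drop s w))" for j
    using smin[of "s + j"] by (simp add: height_take_drop)
  have pos: "0 \<le> height f (take i g)" for i
  proof (cases "i - l \<le> m - s")
    case True
    then show ?thesis
      using e v0[of "i - l"] by (simp add: tk excursions_def)
  next
    case False
    then have "take (i - l) (drop s w) = drop s w"
      using len by simp
    moreover have "height f (take i e) \<ge> 0"
      using e by (simp add: excursions_def)
    \<comment> \<open>The total height of \<open>w\<close> is 0, so \<open>drop s w\<close> climbs
      by minus the minimum, which is at least what any prefix of \<open>take s w\<close> can
      descend.\<close>
    moreover have "height f (take j (take s w)) + height f (drop s w) \<ge> 0" for j
      using smin[of "min j s"] hw by (simp add: take_take)
    ultimately show ?thesis
      unfolding tk by (smt (verit))
  qed
  have "set g \<subseteq> A"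
    using e w by (auto simp: g_def excursions_def bridges_def dest: in_set_takeD in_set_dropD)
  then show "g \<in> excursions f A (l + m)"
    using pos len he hw by (auto simp: excursions_def bridges_def g_def)
  have "height f (take j g) \<noteq> 0" if "l < j" "j \<le> l + m - s" for j
  proof -
    have "take j e = e" "j - l - (m - s) = 0"
      using that len by auto
    moreover have "0 < height f (take (j - l) (drop s w))"
      using smin'[of "s + (j - l)"] that len by (simp add: height_take_drop)
    ultimately show ?thesis
      using he by (simp add: tk)
  qed
  then show "last_zero f g (l + m - s) l"
    using len he by (simp add: last_zero_def g_def)
qed

text \<open>The inverse direction. The end of \<open>g\<close> becomes position \<open>n - p\<close>
  of \<open>w\<close>, at height minus that of the mark. Earlier points of \<open>w\<close> are not
  lower, since \<open>g\<close> is nonnegative; later ones are strictly higher, since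
  \<open>g\<close> has no zero after \<open>q\<close> up to \<open>p\<close>.\<close>

lemma bridge_of_excursion:
  assumes g: "g \<in> excursions f A n" and p: "p < n" and q: "last_zero f g p q"
  defines "w \<equiv> drop p g @ take (p - q) (drop q g)"
  shows "take q g \<in> excursions f A q" "w \<in> bridges f A (n - q)" "last_min f w (n - p)"
proof -
  have len: "length g = n" "q \<le> p" "height f (take q g) = 0" "height f g = 0" "set g \<subseteq> A"
    using g q by (auto simp: excursions_def bridges_def last_zero_def)
  have pos: "0 \<le> height f (take i g)" for i
    using g by (auto simp: excursions_def)
  show "take q g \<in> excursions f A q"
    using len p pos by (auto simp: excursions_def bridges_def dest: in_set_takeD)
  have hp: "height f (drop p g) = - height f (take p g)"
    using len(4) height_append[of f "take p g" "drop p g"] by simp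
  have hu: "height f (take j (drop q g)) = height f (take (q + j) g)" for j
    using len by (simp add: height_take_drop)
  have "set w \<subseteq> A"
    using len(5) by (auto simp: w_def dest!: in_set_takeD in_set_dropD)
  then show "w \<in> bridges f A (n - q)"
    using len p hp hu[of "p - q"] by (auto simp: bridges_def w_def)
  have tk: "height f (take i w) = height f (take i (drop p g)) +
      height f (take (min (i - (n - p)) (p - q)) (drop q g))" for i
    using len by (simp add: w_def)
  have at: "height f (take (n - p) w) = - height f (take p g)"
    using hp len by (simp add: w_def)
  have "- height f (take p g) \<le> height f (take j w)" if "j \<le> n - p" for j
    using that pos[of "p + j"] by (simp add: tk height_take_drop)
  moreover have "- height f (take p g) < height f (take j w)" if "n - p < j" "j \<le> length w" for j
  proof -
    have j: "j \<le> n - q"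
      using that(2) len p by (simp add: w_def)
    define i where "i = j - (n - p)"
    have i: "0 < i" "i \<le> p - q"
      using that j p len by (auto simp: i_def)
    have "height f (take (q + i) g) \<noteq> 0"
      using q i unfolding last_zero_def by auto
    then have "0 < height f (take (q + i) g)"
      using pos[of "q + i"] by simp
    moreover have "take j (drop p g) = drop p g"
      using that len by simp
    ultimately show ?thesis
      using i hp unfolding tk i_def[symmetric] by (simp add: hu min_absorb1)
  qed
  ultimately show "last_min f w (n - p)"
    unfolding last_min_def at using len p by (auto simp: w_def)
qed

text \<open>The left side counts excursions with a mark \<open>p < n\<close>. On the right,
  \<open>m\<close> is the length of the piece after the last zero at or before the mark.\<close>

lemma card_excursions_recurrence:
  assumes "finite A"
  shows "n * card (excursions f A n) =
    (\<Sum>m=1..n. card (bridges f A m) * card (excursions f A (n - m)))"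
proof -
  define lm where "lm w = (THE s. last_min f w s)" for w
  define lz where "lz g p = (THE q. last_zero f g p q)" for g p
  have lm: "last_min f w (lm w)" for w
    unfolding lm_def using last_min_exists last_min_unique by (metis theI)
  have lz: "last_zero f g p (lz g p)" for g p
    unfolding lz_def using last_zero_exists last_zero_unique by (metis theI)
  have lm_eq: "lm w = s" if "last_min f w s" for w s
    using last_min_unique[OF lm that] .
  have lz_eq: "lz g p = q" if "last_zero f g p q" for g p q
    using last_zero_unique[OF lz that] .
  \<comment> \<open>\<open>F\<close> cuts at the last zero and rotates the second piece to start at
    the mark; \<open>G\<close> rotates it back at its last minimum and reads off the mark as
    \<open>n - lm w\<close>.\<close>
  define F where "F = (\<lambda>(g, p). (n - lz g p, drop p g @ take (p - lz g p) (drop (lz g p) g), take (lz g p) g))"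
  define G where "G = (\<lambda>(m :: nat, w, e). (e @ drop (lm w) w @ take (lm w) w, n - lm w))"
  let ?X = "excursions f A n \<times> {..<n}"
  let ?Y = "SIGMA m:{1..n}. bridges f A m \<times> excursions f A (n - m)"
  have FX: "F x \<in> ?Y \<and> G (F x) = x" if "x \<in> ?X" for x
  proof -
    obtain g p where x: "x = (g, p)" and g: "g \<in> excursions f A n" and p: "p < n"
      using \<open>x \<in> ?X\<close> by auto
    define q where "q = lz g p"
    have q: "last_zero f g p q"
      by (simp add: q_def lz)
    then have qp: "q \<le> p"
      by (simp add: last_zero_def)
    note B = bridge_of_excursion[OF g p q]
    have len: "length g = n"
      using g by (simp add: excursions_def bridges_def)
    have "lm (drop p g @ take (p - q) (drop q g)) = n - p"
      by (rule lm_eq) (rule B)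
    moreover have "take (p - q) (drop q g) @ drop p g = drop q g"
      using qp by (metis append_take_drop_id drop_drop le_add_diff_inverse2)
    ultimately show ?thesis
      using B p qp len by (auto simp: x F_def G_def q_def[symmetric])
  qed
  have GY: "G y \<in> ?X \<and> F (G y) = y" if "y \<in> ?Y" for y
  proof -
    obtain m w e where y: "y = (m, w, e)" and m: "1 \<le> m" "m \<le> n"
      and w: "w \<in> bridges f A m" and e: "e \<in> excursions f A (n - m)"
      using \<open>y \<in> ?Y\<close> by auto
    define s where "s = lm w"
    have s: "last_min f w s"
      by (simp add: s_def lm)
    have len: "length w = m" "s \<le> m" "length e = n - m"
      using w e s by (auto simp: last_min_def bridges_def excursions_def)
    note E = excursion_of_bridge[OF e w s]
    have "lz (e @ drop s w @ take s w) (n - s) = n - m"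
      by (rule lz_eq) (use E m in simp)
    then show ?thesis
      using E last_min_pos[OF w m(1) s] m len
      by (auto simp: y F_def G_def s_def[symmetric])
  qed
  have "bij_betw F ?X ?Y"
  proof (rule bij_betw_byWitness[of _ G])
    show "\<forall>x\<in>?X. G (F x) = x"
      by (intro ballI FX[THEN conjunct2])
    show "\<forall>y\<in>?Y. F (G y) = y"
      by (intro ballI GY[THEN conjunct2])
    show "F ` ?X \<subseteq> ?Y"
      by (intro image_subsetI FX[THEN conjunct1])
    show "G ` ?Y \<subseteq> ?X"
      by (intro image_subsetI GY[THEN conjunct1])
  qed
  then have "card ?X = card ?Y"
    by (rule bij_betw_same_card)
  moreover have "card ?X = n * card (excursions f A n)"
    by (simp add: card_cartesian_product mult.commute)
  moreover have "card ?Y = (\<Sum>m=1..n. card (bridges f A m \<times> excursions f A (n - m)))"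
    by (rule card_SigmaI) (auto intro: finite_bridges finite_excursions assms)
  ultimately show ?thesis
    by (simp add: card_cartesian_product)
qed


section \<open>Sums over partitions\<close>

text \<open>One further copy of \<open>i\<close> raises the exponent and the argument of the
  factorial by one and leaves the other factors alone.\<close>

lemma z_partition_add_mset:
  "z_partition (add_mset i \<mu>) = i * (count \<mu> i + 1) * z_partition \<mu>"
proof -
  \<comment> \<open>An absent part contributes \<open>j ^ 0 * fact 0 = 1\<close>, so the products
    for \<open>\<mu>\<close> and \<open>add_mset i \<mu>\<close> can share one index set.\<close>
  have "z_partition \<nu> = (\<Prod>j\<in>I. j ^ count \<nu> j * fact (count \<nu> j))"
    if "set_mset \<nu> \<subseteq> I" "finite I" for \<nu> I
    unfolding z_partition_def
    by (rule prod.mono_neutral_left) (use that in \<open>auto simp: not_in_iff\<close>)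
  note * = this[of _ "insert i (set_mset \<mu>)"]
  have "z_partition (add_mset i \<mu>) =
      (i ^ Suc (count \<mu> i) * fact (Suc (count \<mu> i))) *
      (\<Prod>j\<in>set_mset \<mu> - {i}. j ^ count \<mu> j * fact (count \<mu> j))"
    by (simp add: * prod.insert_remove)
  moreover have "z_partition \<mu> = (i ^ count \<mu> i * fact (count \<mu> i)) *
      (\<Prod>j\<in>set_mset \<mu> - {i}. j ^ count \<mu> j * fact (count \<mu> j))"
    by (simp add: * subset_insertI prod.insert_remove)
  ultimately show ?thesis
    by (simp add: algebra_simps)
qed

lemma z_partition_pos: "0 \<notin># \<mu> \<Longrightarrow> 0 < z_partition \<mu>"
  unfolding z_partition_def by (intro prod_pos) (use gr0I in fastforce)

text \<open>If the \<open>p j\<close> are power sums, this is the expansion of the complete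
  homogeneous symmetric function of degree \<open>n\<close>.\<close>

definition partition_sum :: "(nat \<Rightarrow> real) \<Rightarrow> nat \<Rightarrow> real" where
  "partition_sum p n = (\<Sum>\<mu>\<in>partitions_of n. (\<Prod>j\<in>#\<mu>. p j) / real (z_partition \<mu>))"

lemma partitions_of_0: "partitions_of 0 = {{#}}"
  by (auto simp: partitions_of_def) (metis multiset_nonemptyE sum_mset_0_iff)

lemma partition_sum_0: "partition_sum p 0 = 1"
  by (simp add: partition_sum_def partitions_of_0 z_partition_def)

lemma sum_mset_eq_sum_count:
  fixes \<mu> :: "nat multiset"
  shows "\<Sum>\<^sub># \<mu> = (\<Sum>i\<in>set_mset \<mu>. i * count \<mu> i)"
proof -
  have "(\<Sum>i\<in>I. i * count \<nu> i) = \<Sum>\<^sub># \<nu>" if "set_mset \<nu> \<subseteq> I" "finite I" for \<nu> :: "nat multiset" and I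
    using that
  proof (induction \<nu>)
    case (add x \<nu>)
    have "(\<Sum>i\<in>I. i * count (add_mset x \<nu>) i) = (\<Sum>i\<in>I. i * count \<nu> i + (if i = x then x else 0))"
      by (rule sum.cong) auto
    then show ?case
      using add by (simp add: sum.distrib)
  qed simp
  then show ?thesis
    by simp
qed

text \<open>Newton's identity. Write \<open>n\<close> as the sum of \<open>i * count \<mu> i\<close>
  over the distinct parts \<open>i\<close> of \<open>\<mu>\<close>; removing one copy of
  \<open>i\<close> divides \<open>z_partition\<close> by exactly this factor and splits off
  \<open>p i\<close>.\<close>

lemma partition_sum_recurrence:
  "real n * partition_sum p n = (\<Sum>m=1..n. p m * partition_sum p (n - m))"
proof -
  define g where "g \<mu> = (\<Prod>j\<in>#\<mu>. p j) / real (z_partition \<mu>)" for \<mu>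
  have "real n * g \<mu> = (\<Sum>i\<in>set_mset \<mu>. real i * real (count \<mu> i) * g \<mu>)"
    if "\<mu> \<in> partitions_of n" for \<mu>
  proof -
    have "n = (\<Sum>i\<in>set_mset \<mu>. i * count \<mu> i)"
      using that sum_mset_eq_sum_count[of \<mu>] by (simp add: partitions_of_def)
    then have "real n = (\<Sum>i\<in>set_mset \<mu>. real i * real (count \<mu> i))"
      by (metis (no_types, lifting) of_nat_mult of_nat_sum sum.cong)
    then show ?thesis
      by (simp add: sum_distrib_right)
  qed
  then have "real n * partition_sum p n =
      (\<Sum>\<mu>\<in>partitions_of n. \<Sum>i\<in>set_mset \<mu>. real i * real (count \<mu> i) * g \<mu>)"
    unfolding partition_sum_def g_def[symmetric] by (simp add: sum_distrib_left)
  also have "\<dots> = (\<Sum>(\<mu>, i)\<in>(SIGMA \<mu>:partitions_of n. set_mset \<mu>). real i * real (count \<mu> i) * g \<mu>)"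
    by (rule sum.Sigma) (auto simp: finite_partitions_of)
  also have "\<dots> = (\<Sum>(m, \<nu>)\<in>(SIGMA m:{1..n}. partitions_of (n - m)). p m * g \<nu>)"
  proof (rule sum.reindex_bij_witness[of _ "\<lambda>(m, \<nu>). (add_mset m \<nu>, m)" "\<lambda>(\<mu>, i). (i, \<mu> - {#i#})"])
    fix x assume "x \<in> (SIGMA \<mu>:partitions_of n. set_mset \<mu>)"
    then obtain i \<nu> where x: "x = (add_mset i \<nu>, i)" and "add_mset i \<nu> \<in> partitions_of n"
      by (auto dest!: multi_member_split)
    then have "i > 0" "0 \<notin># \<nu>" "i + \<Sum>\<^sub># \<nu> = n"
      by (auto simp: partitions_of_def)
    then show "(case x of (\<mu>, i) \<Rightarrow> (i, \<mu> - {#i#})) \<in> (SIGMA m:{1..n}. partitions_of (n - m))"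
      and "(case (case x of (\<mu>, i) \<Rightarrow> (i, \<mu> - {#i#})) of (m, \<nu>) \<Rightarrow> (add_mset m \<nu>, m)) = x"
      by (auto simp: x partitions_of_def)
    \<comment> \<open>The ratio of the two values of \<open>z_partition\<close>, which is also part
      times multiplicity in \<open>add_mset i \<nu>\<close>, so it cancels.\<close>
    define k where "k = real (i * (count \<nu> i + 1))"
    have "k \<noteq> 0"
      using \<open>i > 0\<close> unfolding k_def of_nat_eq_0_iff by simp
    moreover have "real i * real (count (add_mset i \<nu>) i) = k"
      by (simp add: k_def distrib_left)
    moreover have "g (add_mset i \<nu>) = p i * (\<Prod>j\<in>#\<nu>. p j) / (k * real (z_partition \<nu>))"
      unfolding g_def z_partition_add_mset k_def of_nat_mult by simp
    ultimately show "(case (case x of (\<mu>, i) \<Rightarrow> (i, \<mu> - {#i#})) of (m, \<nu>) \<Rightarrow> p m * g \<nu>) =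
        (case x of (\<mu>, i) \<Rightarrow> real i * real (count \<mu> i) * g \<mu>)"
      by (simp add: x g_def[of \<nu>] del: count_add_mset)
  next
    fix y assume "y \<in> (SIGMA m:{1..n}. partitions_of (n - m))"
    then show "(case y of (m, \<nu>) \<Rightarrow> (add_mset m \<nu>, m)) \<in> (SIGMA \<mu>:partitions_of n. set_mset \<mu>)"
      and "(case (case y of (m, \<nu>) \<Rightarrow> (add_mset m \<nu>, m)) of (\<mu>, i) \<Rightarrow> (i, \<mu> - {#i#})) = y"
      by (auto simp: partitions_of_def)
  qed
  also have "\<dots> = (\<Sum>m=1..n. \<Sum>\<nu>\<in>partitions_of (n - m). p m * g \<nu>)"
    by (rule sum.Sigma[symmetric]) (auto simp: finite_partitions_of)
  also have "\<dots> = (\<Sum>m=1..n. p m * partition_sum p (n - m))"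
    by (simp add: partition_sum_def g_def sum_distrib_left)
  finally show ?thesis .
qed

text \<open>As \<open>m\<close> starts at 1, the recurrence determines each value from smaller
  arguments after division by \<open>n\<close>; at \<open>n = 0\<close> it says nothing, hence the
  initial value.\<close>

lemma partition_sum_unique:
  fixes h :: "nat \<Rightarrow> real"
  assumes "h 0 = 1" and "\<And>n. real n * h n = (\<Sum>m=1..n. p m * h (n - m))"
  shows "h n = partition_sum p n"
proof (induction n rule: less_induct)
  case (less n)
  show ?case
  proof (cases "n = 0")
    case False
    have "real n * h n = real n * partition_sum p n"
      unfolding assms(2) partition_sum_recurrence
      by (rule sum.cong) (use less False in auto)
    then show ?thesis
      using False by simp
  qed (simp add: assms partition_sum_0)
qed


section \<open>Counting bounded words by their sum\<close>

text \<open>The lattice points of the cube of side \<open>t\<close>, written as lists so that they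
  can be cut into blocks.\<close>

definition bounded_words :: "nat \<Rightarrow> nat \<Rightarrow> nat list set" where
  "bounded_words t N = {xs. set xs \<subseteq> {..t} \<and> length xs = N}"

lemma finite_bounded_words: "finite (bounded_words t N)"
  unfolding bounded_words_def by (rule finite_lists_length_eq) simp

text \<open>The coefficient of X^s in (1 + X + ... + X^t)^N. An integer \<open>s\<close> lets the
  recursion subtract a letter larger than \<open>s\<close> and reach the count 0.\<close>

definition sum_count :: "nat \<Rightarrow> nat \<Rightarrow> int \<Rightarrow> nat" where
  "sum_count t N s = card {xs \<in> bounded_words t N. int (sum_list xs) = s}"

lemma sum_count_0: "sum_count t 0 s = (if s = 0 then 1 else 0)"
proof -
  have "{xs \<in> bounded_words t 0. int (sum_list xs) = s} = (if s = 0 then {[]} else {})"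
    by (auto simp: bounded_words_def)
  then show ?thesis
    by (simp add: sum_count_def)
qed

lemma sum_count_Suc: "sum_count t (Suc N) s = (\<Sum>i\<le>t. sum_count t N (s - int i))"
proof -
  let ?B = "\<lambda>i. {xs \<in> bounded_words t N. int (sum_list xs) = s - int i}"
  have "{xs \<in> bounded_words t (Suc N). int (sum_list xs) = s} = (\<Union>i\<le>t. (#) i ` ?B i)"
    by (auto simp: bounded_words_def length_Suc_conv image_iff)
  moreover have "card (\<Union>i\<le>t. (#) i ` ?B i) = (\<Sum>i\<le>t. card ((#) i ` ?B i))"
    by (rule card_UN_disjoint) (auto simp: finite_bounded_words)
  ultimately show ?thesis
    by (simp add: sum_count_def card_image)
qed

text \<open>The coefficients of \<open>1 / (1 - X) ^ N\<close>, extended by zero to negative exponents.\<close>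

definition neg_binomial_coeff :: "nat \<Rightarrow> int \<Rightarrow> real" where
  "neg_binomial_coeff N u = (if u < 0 then 0 else if N = 0 then (if u = 0 then 1 else 0)
     else real ((nat u + N - 1) choose (N - 1)))"

text \<open>Multiplication of the series by 1 - X; for positive \<open>u\<close> and
  \<open>N\<close> it is Pascal's rule.\<close>

lemma neg_binomial_coeff_Suc:
  "neg_binomial_coeff N u = neg_binomial_coeff (Suc N) u - neg_binomial_coeff (Suc N) (u - 1)"
proof (cases "u \<le> 0")
  case False
  then obtain v where u: "u = int (Suc v)"
    by (metis not_le pos_int_cases Suc_pred)
  then have n: "nat u = Suc v" "nat (u - 1) = v"
    by auto
  show ?thesis
  proof (cases N)
    case (Suc M)
    then show ?thesis
      using n u by (simp add: neg_binomial_coeff_def)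
  qed (use n u in \<open>auto simp: neg_binomial_coeff_def\<close>)
qed (auto simp: neg_binomial_coeff_def)

text \<open>The preceding difference formula telescopes: 1 + X + ... + X^t equals (1 - X^(t+1)) / (1
  - X).\<close>

lemma sum_neg_binomial_coeff:
  "(\<Sum>i\<le>t. neg_binomial_coeff N (u - int i)) =
     neg_binomial_coeff (Suc N) u - neg_binomial_coeff (Suc N) (u - int t - 1)"
  by (induction t) (simp_all add: neg_binomial_coeff_Suc[of N] algebra_simps)

text \<open>Extracting coefficients from \<open>(1 - X ^ (t + 1)) ^ N / (1 - X) ^ N\<close>.\<close>

lemma sum_count_eq:
  "real (sum_count t N s) =
     (\<Sum>j\<le>N. (-1) ^ j * real (N choose j) * neg_binomial_coeff N (s - int j * (int t + 1)))"
proof (induction N arbitrary: s)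
  case 0
  then show ?case
    by (simp add: sum_count_0 neg_binomial_coeff_def)
next
  case (Suc N)
  define q where "q j = neg_binomial_coeff (Suc N) (s - int j * (int t + 1))" for j
  have "real (sum_count t (Suc N) s) = (\<Sum>i\<le>t. \<Sum>j\<le>N. (-1) ^ j * real (N choose j) *
      neg_binomial_coeff N (s - int i - int j * (int t + 1)))"
    by (simp add: sum_count_Suc Suc.IH)
  also have "\<dots> = (\<Sum>j\<le>N. \<Sum>i\<le>t. (-1) ^ j * real (N choose j) *
      neg_binomial_coeff N (s - int i - int j * (int t + 1)))"
    by (rule sum.swap)
  also have "\<dots> = (\<Sum>j\<le>N. (-1) ^ j * real (N choose j) *
      (\<Sum>i\<le>t. neg_binomial_coeff N ((s - int j * (int t + 1)) - int i)))"
    by (simp add: sum_distrib_left algebra_simps)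
  also have "\<dots> = (\<Sum>j\<le>N. (-1) ^ j * real (N choose j) * (q j - q (Suc j)))"
    unfolding sum_neg_binomial_coeff q_def by (simp add: algebra_simps)
  also have "\<dots> = (\<Sum>j\<le>N. (-1) ^ j * real (N choose j) * q j) +
      (\<Sum>j\<le>N. (-1) ^ Suc j * real (N choose j) * q (Suc j))"
    by (simp add: sum.distrib[symmetric] algebra_simps)
  \<comment> \<open>The added term vanishes because \<open>N choose Suc N = 0\<close>. After the
    shift both sums run over \<open>q (Suc j)\<close>, and Pascal's rule merges them.\<close>
  also have "(\<Sum>j\<le>N. (-1) ^ j * real (N choose j) * q j) =
      (\<Sum>j\<le>Suc N. (-1) ^ j * real (N choose j) * q j)"
    by simp
  also have "\<dots> = q 0 + (\<Sum>j\<le>N. (-1) ^ Suc j * real (N choose Suc j) * q (Suc j))"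
    by (subst sum.atMost_Suc_shift) simp
  also have "\<dots> + (\<Sum>j\<le>N. (-1) ^ Suc j * real (N choose j) * q (Suc j)) =
      q 0 + (\<Sum>j\<le>N. (-1) ^ Suc j * real (Suc N choose Suc j) * q (Suc j))"
    by (simp add: sum.distrib[symmetric] algebra_simps)
  also have "\<dots> = (\<Sum>j\<le>Suc N. (-1) ^ j * real (Suc N choose j) * q j)"
    by (subst sum.atMost_Suc_shift) simp
  finally show ?case
    by (simp add: q_def)
qed

text \<open>The polynomial \<open>(u + N - 1) choose (N - 1)\<close> in \<open>u\<close> also vanishes for
  \<open>- N < u < 0\<close>, which covers all the negative arguments that occur for \<open>t \<ge> 1\<close>.\<close>

lemma neg_binomial_coeff_gbinomial:
  assumes "N \<ge> 1" "- int N < u"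
  shows "neg_binomial_coeff N u = (real_of_int u + real (N - 1)) gchoose (N - 1)"
proof (cases "u < 0")
  case True
  define i where "i = nat (u + int (N - 1))"
  have "real_of_int u + real (N - 1) = real i" "i < N - 1"
    using assms True by (auto simp: i_def)
  then show ?thesis
    using True by (simp add: neg_binomial_coeff_def binomial_gbinomial[symmetric])
next
  case False
  have "real_of_int u + real (N - 1) = real (nat u + N - 1)"
    using False assms by simp
  then show ?thesis
    using False assms unfolding neg_binomial_coeff_def by (simp only: binomial_gbinomial) simp
qed

text \<open>For \<open>s = t * k\<close> the argument in \<open>sum_count_eq\<close> is
  \<open>t * (k - j) - j\<close>. It is negative for \<open>j \<ge> k\<close>, so the range of
  summation does not depend on \<open>t\<close>; for \<open>j < k\<close> it exceeds
  \<open>- N\<close>, where the coefficient is the value of a polynomial.\<close>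

lemma sum_count_polynomial:
  assumes "1 \<le> k" "k \<le> N"
  shows "\<exists>p. \<forall>t\<ge>1. poly p (real t) = real (sum_count t N (int (t * k)))"
proof -
  \<comment> \<open>The polynomial in \<open>t\<close> for
    \<open>(u + N - 1) gchoose (N - 1)\<close> at \<open>u = t * (k - j) - j\<close>: each factor
    has slope \<open>k - j\<close> and constant term \<open>N - 1 - j - i\<close>.\<close>
  define c :: "nat \<Rightarrow> real poly" where
    "c j = smult (1 / fact (N - 1)) (\<Prod>i = 0..<N - 1. [:real (N - 1) - real j - real i, real k - real j:])" for j
  have c: "poly (c j) (real t) = (real_of_int (int (t * k) - int j * (int t + 1)) + real (N - 1)) gchoose (N - 1)"
    for j t
    unfolding c_def gbinomial_prod_rev by (simp add: poly_prod algebra_simps)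
  define p where "p = (\<Sum>j<k. smult ((-1) ^ j * real (N choose j)) (c j))"
  have "poly p (real t) = real (sum_count t N (int (t * k)))" if "t \<ge> 1" for t
  proof -
    define u where "u j = int (t * k) - int j * (int t + 1)" for j
    have "u j < 0" if "j \<notin> {..<k}" for j
    proof -
      have "t * k \<le> t * j" "0 < j"
        using that assms by auto
      then have "int t * int k \<le> int t * int j" "0 < int j"
        by (metis of_nat_le_iff of_nat_mult, simp)
      then show ?thesis
        by (simp add: u_def algebra_simps)
    qed
    then have "real (sum_count t N (int (t * k))) =
        (\<Sum>j<k. (-1) ^ j * real (N choose j) * neg_binomial_coeff N (u j))"
      unfolding sum_count_eq u_def[symmetric]
      by (intro sum.mono_neutral_right) (use assms in \<open>auto simp: neg_binomial_coeff_def\<close>)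
    also have "\<dots> = (\<Sum>j<k. (-1) ^ j * real (N choose j) * poly (c j) (real t))"
    proof (rule sum.cong)
      fix j assume "j \<in> {..<k}"
      then have "t * Suc j \<le> t * k"
        by (intro mult_le_mono) auto
      then have "int t * int j + int t \<le> int t * int k"
        by (metis mult_Suc_right of_nat_le_iff of_nat_mult of_nat_add add.commute)
      then have "- int N < u j"
        using \<open>j \<in> {..<k}\<close> assms that by (simp add: u_def algebra_simps)
      then show "(-1) ^ j * real (N choose j) * neg_binomial_coeff N (u j) =
          (-1) ^ j * real (N choose j) * poly (c j) (real t)"
        using assms by (simp add: c u_def neg_binomial_coeff_gbinomial)
    qed simp
    finally show ?thesis
      by (simp add: p_def poly_sum)
  qed
  then show ?thesis
    by blast
qed


section \<open>Lattice points of Schubert matroid polytopes\<close>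

lemma lookup_scaleR_poly_mapping:
  fixes x :: "'a \<Rightarrow>\<^sub>0 'b::real_vector"
  shows "Poly_Mapping.lookup (c *\<^sub>R x) i = c *\<^sub>R Poly_Mapping.lookup x i"
proof -
  have "finite {i. c *\<^sub>R Poly_Mapping.lookup x i \<noteq> 0}"
    by (rule finite_subset[OF _ finite_keys[of x]]) (auto simp: in_keys_iff)
  then show ?thesis
    by (simp add: scaleR_poly_mapping_def Abs_poly_mapping_inverse)
qed

lemma lookup_indicator_vec:
  assumes "finite B"
  shows "Poly_Mapping.lookup (indicator_vec B) i = (if i \<in> B then 1 else 0)"
  using assms by (simp add: indicator_vec_def lookup_sum lookup_single when_def)

text \<open>One family for both matroids: \<open>s = (\<lambda>_. 0)\<close> gives the uniform
  matroid, the prefix counts of \<open>S\<close> give the Schubert matroid.\<close>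

definition prefix_bases :: "nat \<Rightarrow> nat \<Rightarrow> (nat \<Rightarrow> nat) \<Rightarrow> nat set set" where
  "prefix_bases N k s = {T. T \<subseteq> {1..N} \<and> card T = k \<and> (\<forall>j. s j \<le> card (T \<inter> {..j}))}"

definition prefix_words :: "nat \<Rightarrow> nat \<Rightarrow> nat \<Rightarrow> (nat \<Rightarrow> nat) \<Rightarrow> nat list set" where
  "prefix_words t N k s = {xs \<in> bounded_words t N. sum_list xs = t * k \<and>
     (\<forall>j. t * s j \<le> sum_list (take j xs))}"

text \<open>Passing from \<open>u\<close> to \<open>Suc u\<close> drops the summand
  \<open>u div t\<close> and gains \<open>(u + t) div t\<close>, which is larger by one.\<close>

lemma hermite_identity_div:
  fixes t u :: nat
  assumes "t \<ge> 1"
  shows "(\<Sum>r<t. (u + r) div t) = u"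
proof (induction u)
  case 0
  then show ?case by simp
next
  case (Suc u)
  have "(\<Sum>r<t. (Suc u + r) div t) + u div t = (\<Sum>r<Suc t. (u + r) div t)"
    by (subst sum.lessThan_Suc_shift) simp
  also have "\<dots> = u + (u div t + 1)"
    using Suc assms by simp
  finally show ?case
    by simp
qed

text \<open>Since the letters are at most \<open>t\<close>, the rounded prefix sums \<open>(X\<^sub>j + r) div t\<close> grow by
  at most one in each step. The positions where they grow form a basis, and by the Hermite
  identity these \<open>t\<close> bases add up to the given word.\<close>

lemma prefix_word_decomposition:
  assumes t: "t \<ge> 1" and xs: "xs \<in> prefix_words t N k s"
  shows "\<exists>B. (\<forall>r<t. B r \<in> prefix_bases N k s) \<and>
    (\<forall>i<N. xs ! i = (\<Sum>r<t. if Suc i \<in> B r then 1 else 0))"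
proof -
  define X where "X j = sum_list (take j xs)" for j
  define c where "c r j = (X j + r) div t" for r j
  define B where "B r = {Suc i |i. i < N \<and> c r i < c r (Suc i)}" for r
  have len: "length xs = N" and "set xs \<subseteq> {..t}"
    using xs by (simp_all add: prefix_words_def bounded_words_def)
  then have bd: "xs ! i \<le> t" if "i < N" for i
    using that by (metis atMost_iff nth_mem subsetD)
  have XS: "X (Suc i) = X i + xs ! i" if "i < N" for i
    using that len by (simp add: X_def take_Suc_conv_app_nth)
  have X0: "X 0 = 0"
    by (simp add: X_def)
  have c_step: "c r (Suc i) = c r i + (if Suc i \<in> B r then 1 else 0)" if "i < N" for r i
  proof -
    have "c r (Suc i) \<le> (X i + r + t) div t"
      unfolding c_def using XS[OF that] bd[OF that] by (intro div_le_mono) simp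
    also have "\<dots> = c r i + 1"
      using t by (simp add: c_def)
    finally have "c r (Suc i) \<le> c r i + 1" .
    moreover have "c r i \<le> c r (Suc i)"
      unfolding c_def using XS[OF that] by (intro div_le_mono) simp
    ultimately show ?thesis
      using that by (auto simp: B_def)
  qed
  \<comment> \<open>Elements of \<open>B r\<close> are the increments of \<open>c r\<close>, and the
    initial value \<open>r div t\<close> is 0 because \<open>r < t\<close>.\<close>
  have card_B: "card (B r \<inter> {..j}) = c r j" if "j \<le> N" "r < t" for r j
    using that(1)
  proof (induction j)
    case 0
    have "B r \<inter> {..0} = {}"
      by (auto simp: B_def)
    then show ?case
      using that by (simp add: c_def X0)
  next
    case (Suc j)
    have "B r \<inter> {..Suc j} = (if Suc j \<in> B r then insert (Suc j) (B r \<inter> {..j}) else B r \<inter> {..j})"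
      by (auto simp: atMost_Suc)
    then show ?case
      using Suc c_step[of j r] by simp
  qed
  have BN: "B r \<subseteq> {1..N}" for r
    by (auto simp: B_def)
  have X_ge: "X j \<ge> t * s j" for j
    using xs by (simp add: prefix_words_def X_def)
  have XN: "X j = t * k" if "j \<ge> N" for j
    using xs that len by (simp add: X_def prefix_words_def)
  have card_Br: "card (B r) = k" if "r < t" for r
  proof -
    have "B r = B r \<inter> {..N}"
      using BN[of r] by auto
    then have "card (B r) = c r N"
      using card_B[of N r] that by simp
    then show ?thesis
      using that XN by (simp add: c_def)
  qed
  have "B r \<in> prefix_bases N k s" if r: "r < t" for r
  proof -
    have "s j \<le> card (B r \<inter> {..j})" for j
    proof (cases "j \<le> N")
      case True
      have "s j \<le> X j div t"
        using X_ge[of j] t by (simp add: less_eq_div_iff_mult_less_eq mult.commute)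
      also have "\<dots> \<le> c r j"
        unfolding c_def by (rule div_le_mono) simp
      finally show ?thesis
        using True r by (simp add: card_B)
    next
      case False
      then have "B r \<inter> {..j} = B r"
        using BN[of r] by auto
      \<comment> \<open>Past position \<open>N\<close> the prefix sum stays at \<open>t * k\<close>,
        which bounds \<open>s j\<close> by \<open>k\<close>, the size of \<open>B r\<close>.\<close>
      moreover have "t * s j \<le> t * k"
        using X_ge[of j] XN[of j] False by simp
      ultimately show ?thesis
        using t r by (simp add: card_Br)
    qed
    then show ?thesis
      using BN card_Br r by (simp add: prefix_bases_def)
  qed
  moreover have "xs ! i = (\<Sum>r<t. if Suc i \<in> B r then 1 else 0)" if "i < N" for i
  proof -
    have "X i + xs ! i = (\<Sum>r<t. c r (Suc i))"
      unfolding c_def by (simp add: hermite_identity_div[OF t] XS[OF that])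
    also have "\<dots> = (\<Sum>r<t. c r i) + (\<Sum>r<t. if Suc i \<in> B r then 1 else 0)"
      by (simp add: c_step[OF that] sum.distrib)
    also have "(\<Sum>r<t. c r i) = X i"
      unfolding c_def by (rule hermite_identity_div[OF t])
    finally show ?thesis
      by simp
  qed
  ultimately show ?thesis
    by blast
qed

text \<open>List positions start at 0 and the ground set at 1, hence the shift by
  \<open>Suc\<close>.\<close>

definition word_vec :: "nat list \<Rightarrow> nat \<Rightarrow>\<^sub>0 real" where
  "word_vec xs = (\<Sum>i<length xs. Poly_Mapping.single (Suc i) (real (xs ! i)))"

lemma lookup_word_vec:
  "Poly_Mapping.lookup (word_vec xs) i = (if i \<in> {1..length xs} then real (xs ! (i - 1)) else 0)"
proof (cases i)
  case (Suc m)
  then show ?thesis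
    by (simp add: word_vec_def lookup_sum lookup_single when_def Suc_le_eq)
qed (simp add: word_vec_def lookup_sum lookup_single)

lemma inj_on_word_vec: "inj_on word_vec {xs. length xs = N}"
proof (rule inj_onI)
  fix xs ys assume "xs \<in> {xs. length xs = N}" "ys \<in> {xs. length xs = N}" and eq: "word_vec xs = word_vec ys"
  then have len: "length xs = N" "length ys = N"
    by auto
  show "xs = ys"
  proof (rule nth_equalityI)
    fix i assume "i < length xs"
    then show "xs ! i = ys ! i"
      using arg_cong[OF eq, of "\<lambda>v. Poly_Mapping.lookup v (Suc i)"] len
      by (simp add: lookup_word_vec)
  qed (simp add: len)
qed

lemma convex_bound_ge:
  fixes a :: "'a::linordered_idom"
  assumes "a \<le> x" "a \<le> y" "0 \<le> u" "0 \<le> v" "u + v = 1"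
  shows "a \<le> u * x + v * y"
  using convex_bound_le[of "- x" "- a" "- y" u v] assms by simp

text \<open>All conditions are convex and hold at the indicator vectors, hence on their hull. For
  lattice points of a dilate the converse comes from
  \<open>prefix_word_decomposition\<close>.\<close>

lemma polytope_prefix_bases:
  assumes "y \<in> matroid_polytope ({1..N}, prefix_bases N k s)"
  defines "l \<equiv> Poly_Mapping.lookup y"
  shows "0 \<le> l i" "l i \<le> 1" "i \<notin> {1..N} \<Longrightarrow> l i = 0"
    and "sum l {1..N} = real k" "real (s j) \<le> sum l ({1..N} \<inter> {..j})"
proof -
  let ?C = "{y. (\<forall>i. 0 \<le> Poly_Mapping.lookup y i \<and> Poly_Mapping.lookup y i \<le> (1::real)) \<and>
    (\<forall>i. i \<notin> {1..N} \<longrightarrow> Poly_Mapping.lookup y i = 0) \<and>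
    (\<Sum>i=1..N. Poly_Mapping.lookup y i) = real k \<and>
    (\<forall>j. real (s j) \<le> (\<Sum>i\<in>{1..N} \<inter> {..j}. Poly_Mapping.lookup y i))}"
  have "convex ?C"
    by (rule convexI)
      (auto simp: lookup_add lookup_scaleR_poly_mapping sum.distrib sum_distrib_left[symmetric]
        distrib_right[symmetric] intro: convex_bound_le convex_bound_ge)
  moreover have "indicator_vec B \<in> ?C" if "B \<in> prefix_bases N k s" for B
  proof -
    have B: "B \<subseteq> {1..N}" "card B = k" "\<And>j. s j \<le> card (B \<inter> {..j})"
      using that by (auto simp: prefix_bases_def)
    then have "finite B"
      by (auto intro: finite_subset)
    moreover have "{1..N} \<inter> B = B" "{1..N} \<inter> {..j} \<inter> B = B \<inter> {..j}" for j
      using B(1) by auto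
    ultimately show ?thesis
      using B by (auto simp: lookup_indicator_vec sum.If_cases)
  qed
  ultimately have "matroid_polytope ({1..N}, prefix_bases N k s) \<subseteq> ?C"
    unfolding matroid_polytope_def by (intro hull_minimal) auto
  then have "y \<in> ?C"
    using assms(1) by blast
  then show "0 \<le> l i" "l i \<le> 1" "i \<notin> {1..N} \<Longrightarrow> l i = 0"
    "sum l {1..N} = real k" "real (s j) \<le> sum l ({1..N} \<inter> {..j})"
    unfolding l_def by blast+
qed

lemma sum_list_take_eq:
  "length xs = N \<Longrightarrow> sum_list (take j xs) = (\<Sum>i\<in>{1..N} \<inter> {..j}. xs ! (i - 1))"
proof -
  assume "length xs = N"
  then have "sum_list (take j xs) = (\<Sum>i<min j N. xs ! i)"
    by (simp add: sum_list_sum_nth atLeast0LessThan min.commute)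
  also have "\<dots> = (\<Sum>i\<in>{1..N} \<inter> {..j}. xs ! (i - 1))"
    by (rule sum.reindex_bij_witness[of _ "\<lambda>i. i - 1" Suc]) auto
  finally show ?thesis .
qed

lemma lattice_points_prefix_bases:
  assumes t: "t \<ge> 1"
  shows "(*\<^sub>R) (real t) ` matroid_polytope ({1..N}, prefix_bases N k s) \<inter> int_lattice {1..N} =
    word_vec ` prefix_words t N k s"
proof (intro subset_antisym subsetI)
  fix x assume "x \<in> word_vec ` prefix_words t N k s"
  then obtain xs where x: "x = word_vec xs" and xs: "xs \<in> prefix_words t N k s"
    by blast
  then have len: "length xs = N"
    by (simp add: prefix_words_def bounded_words_def)
  obtain B where B: "\<And>r. r < t \<Longrightarrow> B r \<in> prefix_bases N k s"
    "\<And>i. i < N \<Longrightarrow> xs ! i = (\<Sum>r<t. if Suc i \<in> B r then 1 else 0)"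
    using prefix_word_decomposition[OF t xs] by blast
  \<comment> \<open>The indicators of the \<open>t\<close> bases add up to \<open>x\<close>, so
    their average lies in the polytope and has \<open>x\<close> as its dilate.\<close>
  define y where "y = (\<Sum>r<t. (1 / real t) *\<^sub>R indicator_vec (B r))"
  have "y \<in> matroid_polytope ({1..N}, prefix_bases N k s)"
    unfolding y_def matroid_polytope_def
    by (rule convex_sum[OF _ convex_convex_hull]) (use t B(1) in \<open>auto intro: hull_inc\<close>)
  moreover have "x = real t *\<^sub>R y"
  proof (rule poly_mapping_eqI)
    fix i
    have BN: "B r \<subseteq> {1..N}" if "r < t" for r
      using B(1)[OF that] by (auto simp: prefix_bases_def)
    have fin: "finite (B r)" if "r < t" for r
      using BN[OF that] by (rule finite_subset) simp
    have "Poly_Mapping.lookup (real t *\<^sub>R y) i = (\<Sum>r<t. Poly_Mapping.lookup (indicator_vec (B r)) i)"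
      using t by (simp add: y_def lookup_scaleR_poly_mapping lookup_sum sum_distrib_left)
    also have "\<dots> = (\<Sum>r<t. if i \<in> B r then 1 else 0)"
      by (rule sum.cong) (simp_all add: lookup_indicator_vec[OF fin])
    also have "\<dots> = Poly_Mapping.lookup x i"
    proof (cases "i \<in> {1..N}")
      case True
      then obtain m where m: "i = Suc m" "m < N"
        by (cases i) auto
      then show ?thesis
        by (simp add: x lookup_word_vec len B(2)[of m] del: sum.If_cases)
          (auto intro: sum.cong)
    next
      case False
      then have "i \<notin> B r" if "r < t" for r
        using BN[OF that] by auto
      then show ?thesis
        using False by (auto simp: x lookup_word_vec len)
    qed
    finally show "Poly_Mapping.lookup x i = Poly_Mapping.lookup (real t *\<^sub>R y) i"
      by simp
  qed
  moreover have "x \<in> int_lattice {1..N}"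
    using len by (auto simp: x int_lattice_def in_keys_iff lookup_word_vec split: if_splits)
  ultimately show "x \<in> (*\<^sub>R) (real t) ` matroid_polytope ({1..N}, prefix_bases N k s) \<inter> int_lattice {1..N}"
    by blast
next
  fix x assume "x \<in> (*\<^sub>R) (real t) ` matroid_polytope ({1..N}, prefix_bases N k s) \<inter> int_lattice {1..N}"
  then obtain y where y: "y \<in> matroid_polytope ({1..N}, prefix_bases N k s)" and x: "x = real t *\<^sub>R y"
    and int: "\<And>i. Poly_Mapping.lookup x i \<in> \<int>"
    by (auto simp: int_lattice_def)
  define l where "l = Poly_Mapping.lookup x"
  have l_eq: "l i = real t * Poly_Mapping.lookup y i" for i
    by (simp add: l_def x lookup_scaleR_poly_mapping)
  note P = polytope_prefix_bases[OF y]
  \<comment> \<open>The coordinates are nonnegative integers, so floor and \<open>nat\<close> only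
    change their type.\<close>
  define xs where "xs = map (\<lambda>i. nat \<lfloor>l (Suc i)\<rfloor>) [0..<N]"
  have len: "length xs = N"
    by (simp add: xs_def)
  have xs_nth: "real (xs ! (i - 1)) = l i" if "i \<in> {1..N}" for i
  proof -
    have "0 \<le> l i"
      using P(1) by (simp add: l_eq)
    moreover have "l i \<in> \<int>"
      using int by (simp add: l_def)
    ultimately show ?thesis
      using that by (auto simp: xs_def elim!: Ints_cases)
  qed
  have "x = word_vec xs"
  proof (rule poly_mapping_eqI)
    fix i
    show "Poly_Mapping.lookup x i = Poly_Mapping.lookup (word_vec xs) i"
      unfolding lookup_word_vec len l_def[symmetric] using xs_nth[of i] P(3)[of i] by (simp add: l_eq)
  qed
  moreover have "xs \<in> prefix_words t N k s"
  proof -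
    have "xs ! i \<le> t" if "i < N" for i
    proof -
      have "real (xs ! i) = l (Suc i)"
        using xs_nth[of "Suc i"] that by simp
      also have "\<dots> \<le> real t"
        using P(2)[of "Suc i"] by (simp add: l_eq mult_left_le)
      finally show ?thesis
        by simp
    qed
    then have "xs \<in> bounded_words t N"
      by (auto simp: bounded_words_def len in_set_conv_nth)
    moreover have pre: "real (sum_list (take j xs)) =
        real t * sum (Poly_Mapping.lookup y) ({1..N} \<inter> {..j})" for j
    proof -
      have "real (sum_list (take j xs)) = sum l ({1..N} \<inter> {..j})"
        unfolding sum_list_take_eq[OF len] of_nat_sum by (rule sum.cong) (use xs_nth in auto)
      then show ?thesis
        by (simp add: l_eq sum_distrib_left)
    qed
    have "real (sum_list xs) = real (t * k)"
      using pre[of N] P(4) len by (simp add: atLeastAtMost_def Int_assoc)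
    then have "sum_list xs = t * k"
      by (simp only: of_nat_eq_iff)
    moreover have "t * s j \<le> sum_list (take j xs)" for j
    proof -
      have "real (t * s j) \<le> real (sum_list (take j xs))"
        unfolding pre using P(5)[of j] by (simp add: mult_left_mono)
      then show ?thesis
        by (simp only: of_nat_le_iff)
    qed
    ultimately show ?thesis
      by (simp add: prefix_words_def)
  qed
  ultimately show "x \<in> word_vec ` prefix_words t N k s"
    by blast
qed

lemma lattice_count_prefix_bases:
  assumes "t \<ge> 1"
  shows "lattice_count ({1..N}, prefix_bases N k s) t = card (prefix_words t N k s)"
proof -
  have "inj_on word_vec (prefix_words t N k s)"
    by (rule inj_on_subset[OF inj_on_word_vec[of N]]) (auto simp: prefix_words_def bounded_words_def)
  then show ?thesis
    unfolding lattice_count_def fst_conv lattice_points_prefix_bases[OF assms] by (rule card_image)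
qed


section \<open>Catalan matroids\<close>

lemma uniform_matroid_eq: "uniform_matroid k N = ({1..N}, prefix_bases N k (\<lambda>_. 0))"
  by (simp add: uniform_matroid_def prefix_bases_def)

lemma schubert_matroid_eq:
  assumes "S \<subseteq> {1..N}"
  shows "schubert_matroid N S = ({1..N}, prefix_bases N (card S) (\<lambda>j. card (S \<inter> {..j})))"
proof (rule prod_eqI)
  show "bases (schubert_matroid N S) = bases ({1..N}, prefix_bases N (card S) (\<lambda>j. card (S \<inter> {..j})))"
    using bases_schubert_iff[OF assms] by (auto simp: prefix_bases_def)
qed (simp add: schubert_matroid_def)

lemma lattice_count_uniform:
  assumes "t \<ge> 1"
  shows "lattice_count (uniform_matroid k N) t = sum_count t N (int (t * k))"
  unfolding uniform_matroid_eq lattice_count_prefix_bases[OF assms] prefix_words_def sum_count_def of_nat_eq_iff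
  by simp

text \<open>\<open>ehrhart_poly\<close> is a \<open>THE\<close> term, so its values are known only
  once some polynomial is shown to fit; \<open>sum_count_polynomial\<close> supplies it.\<close>

lemma ehrhart_poly_uniform:
  assumes "1 \<le> k" "k \<le> N" "t \<ge> 1"
  shows "poly (ehrhart_poly (uniform_matroid k N)) (real t) = real (sum_count t N (int (t * k)))"
proof -
  obtain p where p: "\<forall>t\<ge>1. poly p (real t) = real (sum_count t N (int (t * k)))"
    using sum_count_polynomial[OF assms(1,2)] by blast
  then have "is_ehrhart_poly (uniform_matroid k N) p"
    by (simp add: is_ehrhart_poly_def lattice_count_uniform)
  then show ?thesis
    using p assms(3) by (simp add: ehrhart_poly_eqI)
qed

section \<open>Prefix counts of the Catalan set\<close>

lemma catalan_word_nth:
  "i < n * (a + b) \<Longrightarrow> catalan_word a b n ! i = (if i mod (a + b) < a then 0 else 1)"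
proof (induction n arbitrary: i)
  case (Suc n)
  have split: "catalan_word a b (Suc n) = (replicate a 0 @ replicate b 1) @ catalan_word a b n"
    by (simp add: catalan_word_def)
  show ?case
  proof (cases "i < a + b")
    case True
    then show ?thesis
      by (auto simp: split nth_append not_less less_diff_conv2)
  next
    case False
    then show ?thesis
      using Suc.IH[of "i - (a + b)"] Suc.prems by (simp add: split nth_append le_mod_geq)
  qed
qed simp

lemma catalan_set_subset: "catalan_set a b n \<subseteq> {1..n * (a + b)}"
  by (auto simp: catalan_set_def)

lemma Suc_in_catalan_set_iff:
  assumes "i < n * (a + b)"
  shows "Suc i \<in> catalan_set a b n \<longleftrightarrow> a \<le> i mod (a + b)"
  using assms catalan_word_nth[OF assms] by (auto simp: catalan_set_def)

lemma card_catalan_set_Suc: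
  assumes "i < n * (a + b)"
  shows "card (catalan_set a b n \<inter> {..Suc i}) =
    card (catalan_set a b n \<inter> {..i}) + (if a \<le> i mod (a + b) then 1 else 0)"
proof -
  have "catalan_set a b n \<inter> {..Suc i} = (if a \<le> i mod (a + b)
      then insert (Suc i) (catalan_set a b n \<inter> {..i}) else catalan_set a b n \<inter> {..i})"
    using Suc_in_catalan_set_iff[OF assms] by (auto simp: atMost_Suc)
  then show ?thesis
    by simp
qed

text \<open>The truncated difference \<open>r - a\<close> is 0 on the zeros of the block and then
  counts its ones. The count at the block start is assumed, because
  \<open>card_catalan_set_block_end\<close> obtains it inductively from the case
  \<open>r = a + b\<close>.\<close>

lemma card_catalan_set_block:
  assumes "card (catalan_set a b n \<inter> {..q * (a + b)}) = q * b" "q < n" "r \<le> a + b"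
  shows "card (catalan_set a b n \<inter> {..q * (a + b) + r}) = q * b + (r - a)"
  using assms(3)
proof (induction r)
  case (Suc r)
  have "Suc q * (a + b) \<le> n * (a + b)"
    using assms(2) by (intro mult_le_mono) auto
  then have "q * (a + b) + r < n * (a + b)"
    using Suc.prems by simp
  then show ?case
    using Suc by (simp add: card_catalan_set_Suc Suc_diff_le)
qed (use assms in simp)

lemma card_catalan_set_block_end:
  "q \<le> n \<Longrightarrow> card (catalan_set a b n \<inter> {..q * (a + b)}) = q * b"
proof (induction q)
  case 0
  have "catalan_set a b n \<inter> {..0} = {}"
    by (auto simp: catalan_set_def)
  then show ?case
    by simp
next
  case (Suc q)
  then show ?case
    using card_catalan_set_block[of a b n q "a + b"] by (simp add: add_ac)
qed

lemma card_catalan_set_ge: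
  assumes "n * (a + b) \<le> j"
  shows "card (catalan_set a b n \<inter> {..j}) = n * b"
proof -
  have "catalan_set a b n \<inter> {..j} = catalan_set a b n \<inter> {..n * (a + b)}"
    using catalan_set_subset[of a b n] assms by auto
  then show ?thesis
    by (simp add: card_catalan_set_block_end)
qed

lemma card_catalan_set: "card (catalan_set a b n) = n * b"
proof -
  have "catalan_set a b n \<inter> {..n * (a + b)} = catalan_set a b n"
    using catalan_set_subset[of a b n] by auto
  then show ?thesis
    using card_catalan_set_block_end[of n n a b] by simp
qed

section \<open>Cutting words into blocks\<close>

definition block_step :: "nat \<Rightarrow> nat list \<Rightarrow> int" where
  "block_step c xs = int (sum_list xs) - int c"

lemma height_block_step:
  "height (block_step c) w = int (sum_list (concat w)) - int (length w * c)"
  by (induction w) (simp_all add: height_def block_step_def algebra_simps)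

lemma take_concat:
  assumes "\<forall>x\<in>set w. length x = d"
  shows "take (q * d) (concat w) = concat (take q w)"
  using assms
proof (induction w arbitrary: q)
  case (Cons x w)
  then show ?case
    by (cases q) simp_all
qed simp

lemma concat_in_bounded_words:
  "w \<in> {w. set w \<subseteq> bounded_words t d \<and> length w = n} \<Longrightarrow> concat w \<in> bounded_words t (n * d)"
proof (induction n arbitrary: w)
  case (Suc n)
  then show ?case
    by (cases w) (auto simp: bounded_words_def)
qed (simp add: bounded_words_def)

text \<open>All blocks have the same length \<open>d\<close>, so a concatenation can be cut in only
  one way.\<close>

lemma bij_betw_concat:
  "bij_betw concat {w. set w \<subseteq> bounded_words t d \<and> length w = n} (bounded_words t (n * d))"
proof (rule bij_betw_imageI)
  show "inj_on concat {w. set w \<subseteq> bounded_words t d \<and> length w = n}"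
  proof (rule inj_onI)
    fix v w
    assume "v \<in> {w. set w \<subseteq> bounded_words t d \<and> length w = n}"
      "w \<in> {w. set w \<subseteq> bounded_words t d \<and> length w = n}" "concat v = concat w"
    moreover from this have "\<forall>(x, y)\<in>set (zip v w). length x = length y"
      by (fastforce simp: bounded_words_def dest: set_zip_leftD set_zip_rightD)
    ultimately show "v = w"
      using concat_eq_concat_iff[of v w] by simp
  qed
  have "xs \<in> concat ` {w. set w \<subseteq> bounded_words t d \<and> length w = n}"
    if "xs \<in> bounded_words t (n * d)" for xs
    using that
  proof (induction n arbitrary: xs)
    case 0
    then show ?case
      by (auto simp: bounded_words_def)
  next
    case (Suc n)
    then have "drop d xs \<in> bounded_words t (n * d)" and tk: "take d xs \<in> bounded_words t d"
      by (auto simp: bounded_words_def dest: in_set_takeD in_set_dropD)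
    then obtain w where "drop d xs = concat w" "set w \<subseteq> bounded_words t d" "length w = n"
      using Suc.IH by blast
    then have "xs = concat (take d xs # w)"
      by (metis append_take_drop_id concat.simps(2))
    with tk \<open>set w \<subseteq> _\<close> \<open>length w = n\<close> show ?case
      by (intro image_eqI[of _ _ "take d xs # w"]) auto
  qed
  then show "concat ` {w. set w \<subseteq> bounded_words t d \<and> length w = n} = bounded_words t (n * d)"
    using concat_in_bounded_words by blast
qed

lemma bij_betw_restrict:
  assumes "bij_betw f A B" "A' \<subseteq> A" "B' \<subseteq> B" "\<And>x. x \<in> A \<Longrightarrow> x \<in> A' \<longleftrightarrow> f x \<in> B'"
  shows "bij_betw f A' B'"
proof (rule bij_betw_subset[OF assms(1,2)])
  show "f ` A' = B'"
    using assms unfolding bij_betw_def by blast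
qed

text \<open>The constant \<open>t * b\<close> is the average block sum of a word with
  \<open>m\<close> blocks and sum \<open>t * (m * b)\<close>, so total excess 0 fixes exactly this
  sum.\<close>

lemma card_bridges_block_step:
  "card (bridges (block_step (t * b)) (bounded_words t d) m) = sum_count t (m * d) (int (t * (m * b)))"
proof -
  have "height (block_step (t * b)) w = 0 \<longleftrightarrow> int (sum_list (concat w)) = int (t * (m * b))"
    if "length w = m" for w
    using that by (auto simp: height_block_step algebra_simps)
  then have "bij_betw concat (bridges (block_step (t * b)) (bounded_words t d) m)
      {xs \<in> bounded_words t (m * d). int (sum_list xs) = int (t * (m * b))}"
    by (intro bij_betw_restrict[OF bij_betw_concat[of t d m]])
      (auto simp: bridges_def intro: concat_in_bounded_words)
  then show ?thesis
    unfolding sum_count_def by (rule bij_betw_same_card)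
qed

lemma sum_list_le_length: "set xs \<subseteq> {..t::nat} \<Longrightarrow> sum_list xs \<le> t * length xs"
  by (induction xs) auto

text \<open>Within a block the required bound is first constant, while prefix sums never decrease,
  and then grows by \<open>t\<close> per letter, the most a prefix sum can grow. So it follows from
  the block start in the first phase and from the block end in the second.\<close>

lemma prefix_words_catalan_iff:
  assumes xs: "xs \<in> bounded_words t (n * (a + b))" and "a + b > 0"
  shows "xs \<in> prefix_words t (n * (a + b)) (n * b) (\<lambda>j. card (catalan_set a b n \<inter> {..j})) \<longleftrightarrow>
    sum_list xs = t * (n * b) \<and> (\<forall>q\<le>n. t * (q * b) \<le> sum_list (take (q * (a + b)) xs))"
proof -
  define d where "d = a + b"
  define X where "X j = sum_list (take j xs)" for j
  have X_add: "X (j + m) = X j + sum_list (take m (drop j xs))" for j m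
    by (simp add: X_def take_add)
  have upper: "X (j + m) \<le> X j + t * m" for j m
  proof -
    have "set (take m (drop j xs)) \<subseteq> {..t}"
      using xs by (auto simp: bounded_words_def dest!: in_set_takeD in_set_dropD)
    then have "sum_list (take m (drop j xs)) \<le> t * length (take m (drop j xs))"
      by (rule sum_list_le_length)
    also have "\<dots> \<le> t * m"
      by simp
    finally show ?thesis
      by (simp add: X_add)
  qed
  have "t * card (catalan_set a b n \<inter> {..j}) \<le> X j"
    if sum: "sum_list xs = t * (n * b)" and ends: "\<forall>q\<le>n. t * (q * b) \<le> X (q * d)" for j
  proof (cases "j < n * d")
    case True
    define q r where "q = j div d" and "r = j mod d"
    have j: "j = q * d + r"
      unfolding q_def r_def by (rule div_mult_mod_eq[symmetric])
    have r: "r < d" and q: "q < n"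
      using assms(2) True by (simp_all add: q_def r_def d_def less_mult_imp_div_less)
    have c: "card (catalan_set a b n \<inter> {..j}) = q * b + (r - a)"
      unfolding j d_def using q r
      by (intro card_catalan_set_block card_catalan_set_block_end) (auto simp: d_def)
    show ?thesis
    proof (cases "r \<le> a")
      case True
      have "t * (q * b) \<le> X (q * d)"
        using ends q by simp
      then show ?thesis
        using True X_add[of "q * d" r] unfolding c by (simp add: j)
    next
      case False
      \<comment> \<open>Work back from the block end: \<open>d - r\<close> ones are still to come,
        and \<open>upper\<close> limits the gain of \<open>X\<close> over them to
        \<open>t * (d - r)\<close>.\<close>
      have "t * (q * b + (r - a)) + t * (d - r) = t * (Suc q * b)"
        using False r by (simp add: d_def flip: distrib_left)
      also have "\<dots> \<le> X (Suc q * d)"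
        using ends[rule_format, of "Suc q"] q by simp
      also have "Suc q * d = j + (d - r)"
        using r by (simp add: j)
      also have "X (j + (d - r)) \<le> X j + t * (d - r)"
        by (rule upper)
      finally show ?thesis
        by (simp add: c)
    qed
  next
    case False
    then have "X j = t * (n * b)"
      using xs sum by (simp add: X_def bounded_words_def d_def)
    then show ?thesis
      using False card_catalan_set_ge[of n a b j] by (simp add: d_def)
  qed
  moreover have "t * (q * b) \<le> X (q * d)"
    if "\<forall>j. t * card (catalan_set a b n \<inter> {..j}) \<le> X j" "q \<le> n" for q
    using spec[OF that(1), of "q * d"] card_catalan_set_block_end[OF that(2), of a b]
    by (simp add: d_def)
  moreover have "xs \<in> prefix_words t (n * d) (n * b) (\<lambda>j. card (catalan_set a b n \<inter> {..j})) \<longleftrightarrow>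
      sum_list xs = t * (n * b) \<and> (\<forall>j. t * card (catalan_set a b n \<inter> {..j}) \<le> X j)"
    using xs by (simp add: prefix_words_def X_def d_def)
  ultimately show ?thesis
    unfolding X_def[symmetric] d_def[symmetric] by blast
qed

lemma card_excursions_block_step:
  assumes "a + b > 0"
  shows "card (excursions (block_step (t * b)) (bounded_words t (a + b)) n) =
    card (prefix_words t (n * (a + b)) (n * b) (\<lambda>j. card (catalan_set a b n \<inter> {..j})))"
proof -
  let ?W = "{w. set w \<subseteq> bounded_words t (a + b) \<and> length w = n}"
  let ?P = "prefix_words t (n * (a + b)) (n * b) (\<lambda>j. card (catalan_set a b n \<inter> {..j}))"
  have iff: "w \<in> excursions (block_step (t * b)) (bounded_words t (a + b)) n \<longleftrightarrow> concat w \<in> ?P"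
    if w: "w \<in> ?W" for w
  proof -
    have len: "\<forall>x\<in>set w. length x = a + b"
      using w by (auto simp: bounded_words_def)
    define S where "S q = sum_list (take (q * (a + b)) (concat w))" for q
    \<comment> \<open>Excursions constrain prefixes of every length, also beyond \<open>n\<close>,
      where \<open>take\<close> is constant; \<open>min q n\<close> translates this to the range
      \<open>q \<le> n\<close>.\<close>
    have S_min: "S (min q n) = S q" for q
      using w by (simp add: S_def take_concat[OF len] min_def)
    have "height (block_step (t * b)) (take q w) = int (S q) - int (t * (min q n * b))" for q
      unfolding height_block_step S_def take_concat[OF len] using w by (simp add: min.commute mult_ac)
    then have ge: "0 \<le> height (block_step (t * b)) (take q w) \<longleftrightarrow> t * (min q n * b) \<le> S q" for q
      by (simp only: diff_ge_0_iff_ge of_nat_le_iff)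
    have "height (block_step (t * b)) w = int (sum_list (concat w)) - int (t * (n * b))"
      using w by (simp add: height_block_step mult_ac)
    then have eq: "height (block_step (t * b)) w = 0 \<longleftrightarrow> sum_list (concat w) = t * (n * b)"
      by (simp only: right_minus_eq of_nat_eq_iff)
    have "(\<forall>q. t * (min q n * b) \<le> S q) \<longleftrightarrow> (\<forall>q\<le>n. t * (q * b) \<le> S q)"
    proof (intro iffI allI impI)
      show "t * (q * b) \<le> S q" if "\<forall>q. t * (min q n * b) \<le> S q" "q \<le> n" for q
        using spec[OF that(1), of q] that(2) by (simp add: min_absorb1)
      show "t * (min q n * b) \<le> S q" if "\<forall>q\<le>n. t * (q * b) \<le> S q" for q
        using that[rule_format, of "min q n"] by (simp add: S_min)
    qed
    then have "w \<in> excursions (block_step (t * b)) (bounded_words t (a + b)) n \<longleftrightarrow>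
      sum_list (concat w) = t * (n * b) \<and> (\<forall>q\<le>n. t * (q * b) \<le> S q)"
      using w by (simp add: excursions_def bridges_def ge eq)
    then show ?thesis
      using prefix_words_catalan_iff[OF concat_in_bounded_words[OF w] assms] by (simp add: S_def)
  qed
  have "excursions (block_step (t * b)) (bounded_words t (a + b)) n \<subseteq> ?W"
    by (auto simp: excursions_def bridges_def)
  moreover have "?P \<subseteq> bounded_words t (n * (a + b))"
    by (auto simp: prefix_words_def)
  ultimately have "bij_betw concat (excursions (block_step (t * b)) (bounded_words t (a + b)) n) ?P"
    using iff by (rule bij_betw_restrict[OF bij_betw_concat])
  then show ?thesis
    by (rule bij_betw_same_card)
qed

lemma lattice_count_catalan:
  assumes "a + b > 0" "t \<ge> 1"
  shows "lattice_count (catalan_matroid a b n) t =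
    card (excursions (block_step (t * b)) (bounded_words t (a + b)) n)"
  unfolding catalan_matroid_def schubert_matroid_eq[OF catalan_set_subset] card_catalan_set
    lattice_count_prefix_bases[OF assms(2)] card_excursions_block_step[OF assms(1)] ..

lemma card_excursions_eq_partition_sum:
  assumes "finite A"
  shows "real (card (excursions f A n)) = partition_sum (\<lambda>m. real (card (bridges f A m))) n"
proof (rule partition_sum_unique)
  have "excursions f A 0 = {[]}"
    by (auto simp: excursions_def bridges_def)
  then show "real (card (excursions f A 0)) = 1"
    by simp
  show "real n * real (card (excursions f A n)) =
      (\<Sum>m=1..n. real (card (bridges f A m)) * real (card (excursions f A (n - m))))" for n
    using arg_cong[OF card_excursions_recurrence[OF assms, of n f], of real] by simp
qed

theorem corollary4p1:
  fixes a b n :: nat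
  assumes "a \<ge> 1" and "b \<ge> 1" and "n \<ge> 1"
  shows "ehrhart_poly (catalan_matroid a b n) =
    (\<Sum>\<mu>\<in>partitions_of n.
       smult (1 / real (z_partition \<mu>)) (ehrhart_poly_uniform_prod a b \<mu>))"
proof (rule ehrhart_poly_eqI, unfold is_ehrhart_poly_def, intro allI impI)
  \<comment> \<open>The right-hand side is a polynomial, so matching the lattice counts for all
    \<open>t \<ge> 1\<close> both proves that the Ehrhart polynomial exists and identifies
    it.\<close>
  fix t :: nat
  assume t: "t \<ge> 1"
  let ?p = "\<lambda>m. real (card (bridges (block_step (t * b)) (bounded_words t (a + b)) m))"
  \<comment> \<open>Parts of a partition are positive, so each rank \<open>m * b\<close> is at least
    1, as \<open>ehrhart_poly_uniform\<close> requires.\<close>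
  have prod: "poly (ehrhart_poly_uniform_prod a b \<mu>) (real t) = (\<Prod>j\<in>#\<mu>. ?p j)" if "0 \<notin># \<mu>" for \<mu>
    using that
  proof (induction \<mu>)
    case (add m \<mu>)
    then have "1 \<le> m * b" "m * b \<le> m * (a + b)"
      using assms by auto
    then have "poly (ehrhart_poly (uniform_ab a b m)) (real t) = ?p m"
      unfolding uniform_ab_def card_bridges_block_step using t by (rule ehrhart_poly_uniform)
    then show ?case
      using add by (simp add: ehrhart_poly_uniform_prod_def)
  qed (simp add: ehrhart_poly_uniform_prod_def)
  have "real (lattice_count (catalan_matroid a b n) t) = partition_sum ?p n"
    using assms t by (simp add: lattice_count_catalan card_excursions_eq_partition_sum finite_bounded_words)
  also have "\<dots> = poly (\<Sum>\<mu>\<in>partitions_of n.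
      smult (1 / real (z_partition \<mu>)) (ehrhart_poly_uniform_prod a b \<mu>)) (real t)"
    unfolding partition_sum_def poly_sum
    by (rule sum.cong) (auto simp: prod partitions_of_def)
  finally show "poly (\<Sum>\<mu>\<in>partitions_of n.
      smult (1 / real (z_partition \<mu>)) (ehrhart_poly_uniform_prod a b \<mu>)) (real t) =
    real (lattice_count (catalan_matroid a b n) t)" ..
qed

end
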